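(* Let $X$ be a sequentially complete Hausdorff locally convex space and $(T(t))_{t\geq 0}$ a strongly continuous semigroup on $X$ with generator $(A,D(A))$. Then the following assertions hold for all $\lambda\in\mathbb{C}$. (a) $\ker(\lambda-A)=\bigcap_{t\geq 0}\ker(\mathrm{e}^{\lambda t}-T(t))$, (b) if $(T(s))_{s\geq 0}$ is locally equicontinuous, then for all $t>0$ \[ \ker(\mathrm{e}^{\lambda t}-T(t))=\overline{\operatorname{span}}\Bigl(\bigcup_{n\in\mathbb{Z}}\ker\bigl(\lambda+\tfrac{2\pi\mathsf{i}n}{t}-A\bigr)\Bigr). \]
   Context: All locally convex spaces have scalar field $\mathbb{C}$. $\Gamma_X$ denotes a fundamental system of seminorms inducing the topology of $X$ (every continuous seminorm is bounded by a constant multiple of a member of $\Gamma_X$), and $\mathcal{L}(X)$ the space of continuous linear operators $X\to X$. A semigroup on $X$ is a family $(T(t))_{t\geq 0}$ in $\mathcal{L}(X)$ with $T(0)=\mathrm{id}$ and $T(t+s)=T(t)T(s)$ for all $t,s\geq 0$. It is strongly continuous if $t\mapsto T(t)x$ is continuous $[0,\infty)\to X$ for every $x\in X$. It is locally equicontinuous if for all $q\in\Gamma_X$ and $t_0\geq 0$ there are $p\in\Gamma_X$, $C\geq 0$ with $q(T(t)x)\leq Cp(x)$ for all $t\in[0,t_0]$, $x\in X$. The generator $(A,D(A))$ is given by $Ax=\lim_{t\to 0+}\frac{T(t)x-x}{t}$ with $D(A)$ the set of all $x\in X$ for which this limit exists in $X$. For $\mu\in\mathbb{C}$, $\ker(\mu-A)=\{x\in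 D(A)\mid Ax=\mu x\}$. $\overline{\operatorname{span}}$ denotes the closure in $X$ of the linear span. *)

theory Defs
  imports "HOL-Analysis.Analysis"
begin

definition seminorm_on :: "(complex \<Rightarrow> 'a::ab_group_add \<Rightarrow> 'a) \<Rightarrow> ('a \<Rightarrow> real) \<Rightarrow> bool" where
  "seminorm_on smul p \<longleftrightarrow>
     (\<forall>x. 0 \<le> p x) \<and>
     (\<forall>x y. p (x + y) \<le> p x + p y) \<and>
     (\<forall>c x. p (smul c x) = cmod c * p x)"

text \<open>
  A Hausdorff locally convex space over the complex numbers is a whole type, with its topology
  and addition taken from the type classes (the class \<open>t2_space\<close> supplies the Hausdorff property),
  and with an explicit scalar multiplication, since the libraries have no class of complex vector
  spaces. The assumption \<open>open_iff\<close> says that \<open>\<Gamma>\<close> induces the topology; \<open>fundamental\<close> is the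
  additional requirement that makes \<open>\<Gamma>\<close> a fundamental system of seminorms.
\<close>

locale hausdorff_lcs = vector_space smul
  for smul :: "complex \<Rightarrow> 'a::{ab_group_add, t2_space} \<Rightarrow> 'a" +
  fixes \<Gamma> :: "('a \<Rightarrow> real) set"
  assumes seminorms: "p \<in> \<Gamma> \<Longrightarrow> seminorm_on smul p"
    and open_iff:
      "open U \<longleftrightarrow>
        (\<forall>x\<in>U. \<exists>F \<epsilon>. finite F \<and> F \<subseteq> \<Gamma> \<and> 0 < \<epsilon> \<and> {y. \<forall>p\<in>F. p (y - x) < \<epsilon>} \<subseteq> U)"
    and fundamental:
      "seminorm_on smul q \<Longrightarrow> continuous_on UNIV q \<Longrightarrow> \<exists>p\<in>\<Gamma>. \<exists>C\<ge>0. \<forall>x. q x \<le> C * p x"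

text \<open>
  Cauchy sequences are those of the additive group: the library constant \<open>Cauchy\<close> needs a
  \<open>uniform_space\<close>, which would have to be tied to the addition separately.
\<close>

definition cauchy_seq :: "(nat \<Rightarrow> 'a::{ab_group_add, topological_space}) \<Rightarrow> bool" where
  "cauchy_seq X \<longleftrightarrow>
     (\<forall>U. open U \<and> 0 \<in> U \<longrightarrow> (\<exists>N. \<forall>m\<ge>N. \<forall>n\<ge>N. X m - X n \<in> U))"

definition sequentially_complete :: "'a::{ab_group_add, topological_space} itself \<Rightarrow> bool" where
  "sequentially_complete _ \<longleftrightarrow> (\<forall>X :: nat \<Rightarrow> 'a. cauchy_seq X \<longrightarrow> convergent X)"

definition continuous_linear_operator ::
    "(complex \<Rightarrow> 'a::{ab_group_add, topological_space} \<Rightarrow> 'a) \<Rightarrow> ('a \<Rightarrow> 'a) \<Rightarrow> bool" where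
  "continuous_linear_operator smul S \<longleftrightarrow>
     Vector_Spaces.linear smul smul S \<and> continuous_on UNIV S"

text \<open>
  Semigroups are functions of a real parameter; only their values at \<open>t \<ge> 0\<close> matter.
\<close>

definition operator_semigroup ::
    "(complex \<Rightarrow> 'a::{ab_group_add, topological_space} \<Rightarrow> 'a) \<Rightarrow> (real \<Rightarrow> 'a \<Rightarrow> 'a) \<Rightarrow> bool" where
  "operator_semigroup smul T \<longleftrightarrow>
     (\<forall>t\<ge>0. continuous_linear_operator smul (T t)) \<and>
     T 0 = id \<and>
     (\<forall>t\<ge>0. \<forall>s\<ge>0. T (t + s) = T t \<circ> T s)"

definition strongly_continuous :: "(real \<Rightarrow> 'a \<Rightarrow> 'a::topological_space) \<Rightarrow> bool" where
  "strongly_continuous T \<longleftrightarrow> (\<forall>x. continuous_on {0..} (\<lambda>t. T t x))"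

definition locally_equicontinuous :: "('a \<Rightarrow> real) set \<Rightarrow> (real \<Rightarrow> 'a \<Rightarrow> 'a) \<Rightarrow> bool" where
  "locally_equicontinuous \<Gamma> T \<longleftrightarrow>
     (\<forall>q\<in>\<Gamma>. \<forall>t\<^sub>0\<ge>0. \<exists>p\<in>\<Gamma>. \<exists>C\<ge>0. \<forall>t\<in>{0..t\<^sub>0}. \<forall>x. q (T t x) \<le> C * p x)"

definition difference_quotient ::
    "(complex \<Rightarrow> 'a::ab_group_add \<Rightarrow> 'a) \<Rightarrow> (real \<Rightarrow> 'a \<Rightarrow> 'a) \<Rightarrow> 'a \<Rightarrow> real \<Rightarrow> 'a" where
  "difference_quotient smul T x t = smul (1 / complex_of_real t) (T t x - x)"

definition generator_domain ::
    "(complex \<Rightarrow> 'a::{ab_group_add, topological_space} \<Rightarrow> 'a) \<Rightarrow> (real \<Rightarrow> 'a \<Rightarrow> 'a) \<Rightarrow> 'a set" where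
  "generator_domain smul T =
     {x. \<exists>y. (difference_quotient smul T x \<longlongrightarrow> y) (at_right 0)}"

text \<open>Outside \<open>generator_domain smul T\<close> the value of the generator is unspecified.\<close>

definition generator ::
    "(complex \<Rightarrow> 'a::{ab_group_add, t2_space} \<Rightarrow> 'a) \<Rightarrow> (real \<Rightarrow> 'a \<Rightarrow> 'a) \<Rightarrow> 'a \<Rightarrow> 'a" where
  "generator smul T x = Lim (at_right 0) (difference_quotient smul T x)"

text \<open>The kernel of \<open>\<mu> - A\<close> for an operator \<open>A\<close> with domain \<open>D\<close>.\<close>

definition ker_minus ::
    "(complex \<Rightarrow> 'a \<Rightarrow> 'a) \<Rightarrow> complex \<Rightarrow> 'a set \<Rightarrow> ('a \<Rightarrow> 'a) \<Rightarrow> 'a set" where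
  "ker_minus smul \<mu> D A = {x \<in> D. A x = smul \<mu> x}"

end

theory Submission
  imports Defs
begin

text \<open>
  For a complex number \<open>\<mu>\<close>, the equation \<open>A x = \<mu> x\<close> says that the curve
  \<open>f s = e\<^bsup>-\<mu>s\<^esup> T(s) x\<close> has right derivative \<open>0\<close> at \<open>0\<close>. Since
  \<open>f (s + h) - f s = e\<^bsup>-\<mu>s\<^esup> T(s) (f h - x)\<close> and \<open>T(s)\<close> is a continuous operator, the
  right derivative is then \<open>0\<close> at every \<open>s\<close>. A continuous curve whose right derivative vanishes
  everywhere is constant, and so \<open>T(s) x = e\<^bsup>\<mu>s\<^esup> x\<close> for all \<open>s \<ge> 0\<close>; the converse is the
  derivative of the exponential function. This is \<open>eigenvector_of_generator_iff\<close>, the first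
  assertion of the theorem.

  For the second assertion let \<open>T(t) x = e\<^bsup>\<lambda>t\<^esup> x\<close>. After rescaling time by \<open>t\<close>, the curve
  \<open>f s = e\<^bsup>-\<lambda>ts\<^esup> T(ts) x\<close> has period \<open>1\<close>, and its Fourier coefficients
  \<open>\<integral> e\<^bsup>2\<pi>iks\<^esup> f s ds\<close> over a period are eigenvectors of \<open>A\<close> for \<open>\<lambda> - 2\<pi>ik/t\<close>: applying
  \<open>T(r)\<close> shifts the argument by \<open>r/t\<close>, up to a scalar factor, and the integral over a period does
  not change under shifts. It remains to see that the value \<open>f 0 = x\<close> lies in the closed span of the
  Fourier coefficients, which follows from the convergence of the convolutions of \<open>f\<close> with
  trigonometric polynomials that form an approximate identity.

  The integrals are limits of the equidistant Riemann sums \<open>mean n (\<lambda>j. h (j / n))\<close>: these are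
  Cauchy sequences (\<open>riemann_sums_cauchy\<close>), and sequential completeness gives the limit. Continuous
  operators commute with finite sums and limits, so \<open>riemann_sums_shift\<close> yields the eigenvectors
  (\<open>orbit_mean_eigenvector\<close>). The approximate identity consists of the powers of
  \<open>(1 + cos (2\<pi>s)) / 2\<close>, normalised by their sums over the grid points. All estimates hold
  on every grid with the same constants (\<open>raised_cosine_concentrates\<close>), so that the comparison with
  \<open>x\<close> can be made on a single fine grid (\<open>value_in_closure_of_fourier_coefficients\<close>).
\<close>

section \<open>A mean value argument for right derivatives\<close>

text \<open>
  For \<open>\<phi> t = p (f t - f 0) - \<epsilon> t\<close> this is the mean value inequality for a curve \<open>f\<close> whose right
  derivative has seminorm less than \<open>\<epsilon>\<close>. If \<open>\<phi> t > 0\<close>, then the last point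
  \<open>s < t\<close> with \<open>\<phi> s \<le> 0\<close> exists by continuity, but the hypothesis at \<open>s\<close> produces a later one.
\<close>

lemma le_zero_by_right_increments:
  fixes \<phi> :: "real \<Rightarrow> real"
  assumes cont: "continuous_on {0..} \<phi>" and "\<phi> 0 \<le> 0"
    and incr: "\<And>s. 0 \<le> s \<Longrightarrow> eventually (\<lambda>h. \<phi> (s + h) \<le> \<phi> s) (at_right 0)"
    and "0 \<le> t"
  shows "\<phi> t \<le> 0"
proof (rule ccontr)
  assume "\<not> \<phi> t \<le> 0"
  define S where "S = {s \<in> {0..t}. \<phi> s \<le> 0}"
  have "continuous_on {0..t} \<phi>" by (rule continuous_on_subset[OF cont]) auto
  then have "closed S" unfolding S_def
    by (intro continuous_closed_preimage_constant continuous_on_closed_Collect_le continuous_on_const) auto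
  moreover have "bounded S" by (rule bounded_subset[of "{0..t}"]) (auto simp: S_def)
  ultimately have "compact S" by (simp add: compact_eq_bounded_closed)
  moreover have "S \<noteq> {}" using assms by (auto simp: S_def)
  ultimately obtain s where s: "s \<in> S" and max: "\<And>u. u \<in> S \<Longrightarrow> u \<le> s"
    using compact_attains_sup by metis
  have st: "0 \<le> s" "s < t" "\<phi> s \<le> 0"
    using s \<open>\<not> \<phi> t \<le> 0\<close> by (auto simp: S_def less_le)
  obtain b where "b > 0" and b: "\<And>h. 0 < h \<Longrightarrow> h < b \<Longrightarrow> \<phi> (s + h) \<le> \<phi> s"
    using incr[OF st(1)] unfolding eventually_at_right_field by auto
  define h where "h = min (b / 2) (t - s)"
  have h: "0 < h" "h < b" "s + h \<le> t" using \<open>b > 0\<close> st by (auto simp: h_def)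
  then have "s + h \<in> S" using b[of h] st by (auto simp: S_def)
  then show False using max[of "s + h"] h by simp
qed

section \<open>Powers of the raised cosine as an approximate identity\<close>

text \<open>
  This is \<open>(cos (\<pi> s))\<^sup>2\<close>: a nonnegative trigonometric polynomial of period \<open>1\<close> that attains its
  maximum \<open>1\<close> exactly at the integers.
\<close>

definition raised_cosine :: "real \<Rightarrow> real" where
  "raised_cosine s = (1 + cos (2 * pi * s)) / 2"

lemma raised_cosine_continuous: "continuous_on A raised_cosine"
  unfolding raised_cosine_def by (intro continuous_intros) auto

lemma raised_cosine_nonneg: "0 \<le> raised_cosine s"
proof -
  have "0 \<le> (1 + c) / 2" if "- 1 \<le> c" for c :: real using that by simp
  then show ?thesis unfolding raised_cosine_def using cos_ge_minus_one by blast
qed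

lemma raised_cosine_less_1:
  assumes "0 < s" "s < 1"
  shows "raised_cosine s < 1"
proof -
  have "cos (2 * pi * s) \<noteq> 1"
  proof
    assume "cos (2 * pi * s) = 1"
    then obtain n :: int where "2 * pi * s = of_int n * 2 * pi"
      unfolding cos_one_2pi_int by auto
    then have "s = of_int n" by simp
    with assms show False by auto
  qed
  then have "cos (2 * pi * s) < 1" using cos_le_one[of "2 * pi * s"]
    by (metis less_le)
  then show ?thesis by (simp add: raised_cosine_def)
qed

text \<open>
  Where \<open>g\<close> is not small, the kernel is at most some \<open>r < 1\<close>, and near \<open>0\<close> it is at least
  some \<open>\<rho> > r\<close>. As the grid points near \<open>0\<close> have a fixed proportion \<open>\<eta>\<close>, the \<open>N\<close>-th powers have
  mean at least \<open>\<eta> \<rho>\<^sup>N\<close>, while the bad part contributes at most \<open>M r\<^sup>N\<close>, which is negligible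
  for large \<open>N\<close>. The choice of \<open>N\<close> and \<open>\<kappa>\<close> is uniform in the grid size \<open>m\<close>.
\<close>

lemma raised_cosine_concentrates:
  fixes g :: "real \<Rightarrow> real"
  assumes g: "continuous_on {0..1} g" "g 0 = 0" "g 1 = 0" and "\<epsilon> > 0"
  obtains N \<kappa> where "\<kappa> > 0"
    and "\<And>m. \<kappa> * real m \<le> (\<Sum>j<m. raised_cosine (real j / real m) ^ N)"
    and "\<And>m. (\<Sum>j<m. raised_cosine (real j / real m) ^ N * g (real j / real m))
              \<le> \<epsilon> * (\<Sum>j<m. raised_cosine (real j / real m) ^ N)"
proof -
  let ?c = raised_cosine
  define K where "K = {s \<in> {0..1}. g s \<ge> \<epsilon> / 2}"
  have "closed K" unfolding K_def
    by (intro continuous_on_closed_Collect_le continuous_on_const g) auto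
  moreover have "bounded K" by (rule bounded_subset[of "{0..1}"]) (auto simp: K_def)
  ultimately have K: "compact K" by (simp add: compact_eq_bounded_closed)
  obtain r where r: "0 \<le> r" "r < 1" "\<And>s. s \<in> K \<Longrightarrow> ?c s \<le> r"
  proof (cases "K = {}")
    case True
    then show ?thesis using that[of 0] by auto
  next
    case False
    then obtain s where s: "s \<in> K" "\<And>u. u \<in> K \<Longrightarrow> ?c u \<le> ?c s"
      using continuous_attains_sup[OF K _ raised_cosine_continuous] by auto
    have "s \<noteq> 0" "s \<noteq> 1" using s(1) g \<open>\<epsilon> > 0\<close> by (auto simp: K_def)
    then have "0 < s" "s < 1" using s(1) by (auto simp: K_def)
    then show ?thesis using that[of "?c s"] s raised_cosine_less_1 raised_cosine_nonneg by auto
  qed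
  define \<rho> where "\<rho> = (1 + r) / 2"
  have \<rho>: "0 < \<rho>" "\<rho> < 1" "r < \<rho>" using r by (auto simp: \<rho>_def)
  have "isCont ?c 0"
    using raised_cosine_continuous[of UNIV] by (simp add: continuous_on_eq_continuous_at)
  then obtain \<delta> where \<delta>: "\<delta> > 0" "\<And>s. \<bar>s\<bar> < \<delta> \<Longrightarrow> \<bar>?c s - ?c 0\<bar> < 1 - \<rho>"
    unfolding continuous_at_eps_delta dist_real_def using \<rho> by (metis diff_0_right diff_gt_0_iff_gt)
  have c0: "?c 0 = 1" by (simp add: raised_cosine_def)
  define \<eta> where "\<eta> = min (\<delta> / 2) (1 / 2)"
  have \<eta>: "0 < \<eta>" "\<eta> < \<delta>" "\<eta> < 1" using \<delta> by (auto simp: \<eta>_def)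
  have near: "\<rho> \<le> ?c s" if "0 \<le> s" "s \<le> \<eta>" for s
    using \<delta>(2)[of s] that \<eta> c0 by auto
  have lower: "\<eta> * \<rho> ^ N * real m \<le> (\<Sum>j<m. ?c (real j / real m) ^ N)" for N m
  proof (cases "m = 0")
    case False
    define k where "k = nat \<lfloor>\<eta> * m\<rfloor>"
    have k: "real k \<le> \<eta> * m" "\<eta> * m \<le> real (Suc k)"
      using \<eta> by (auto simp: k_def) linarith+
    have "k < m"
    proof -
      have "\<eta> * m < m" using \<eta> False by simp
      then show ?thesis using k(1) by linarith
    qed
    have "\<eta> * \<rho> ^ N * real m \<le> real (Suc k) * \<rho> ^ N"
      using mult_right_mono[OF k(2), of "\<rho> ^ N"] \<rho> by (simp add: mult_ac)
    also have "\<dots> = (\<Sum>j<Suc k. \<rho> ^ N)" by simp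
    also have "\<dots> \<le> (\<Sum>j<Suc k. ?c (real j / real m) ^ N)"
    proof (intro sum_mono power_mono near)
      fix j assume "j \<in> {..<Suc k}"
      then have "real j \<le> \<eta> * m" using k by auto
      then show "real j / real m \<le> \<eta>" using False by (simp add: field_simps)
    qed (use \<rho> in auto)
    also have "\<dots> \<le> (\<Sum>j<m. ?c (real j / real m) ^ N)"
      using \<open>k < m\<close> raised_cosine_nonneg by (intro sum_mono2) auto
    finally show ?thesis .
  qed simp
  have "bdd_above (g ` {0..1})"
    by (intro bounded_imp_bdd_above compact_imp_bounded compact_continuous_image g) auto
  then obtain M0 where M0: "\<And>s. s \<in> {0..1} \<Longrightarrow> g s \<le> M0" unfolding bdd_above_def by blast
  define M where "M = max M0 1"
  have M: "M > 0" "\<And>s. s \<in> {0..1} \<Longrightarrow> g s \<le> M" using M0 by (auto simp: M_def le_max_iff_disj)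
  have "(\<lambda>N. (r / \<rho>) ^ N) \<longlonglongrightarrow> 0" using r \<rho> by (intro LIMSEQ_realpow_zero) auto
  then have "eventually (\<lambda>N. (r / \<rho>) ^ N < \<epsilon> / 2 * \<eta> / M) sequentially"
    by (rule order_tendstoD) (use \<open>\<epsilon> > 0\<close> \<eta> M in auto)
  then obtain N where "(r / \<rho>) ^ N < \<epsilon> / 2 * \<eta> / M"
    by (auto simp: eventually_sequentially)
  then have N: "M * r ^ N \<le> \<epsilon> / 2 * (\<eta> * \<rho> ^ N)"
    using M \<rho> by (simp add: power_divide field_simps)
  have upper: "(\<Sum>j<m. ?c (real j / real m) ^ N * g (real j / real m))
      \<le> \<epsilon> * (\<Sum>j<m. ?c (real j / real m) ^ N)" for m
  proof -
    have "(\<Sum>j<m. ?c (real j / real m) ^ N * g (real j / real m))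
        \<le> (\<Sum>j<m. \<epsilon> / 2 * ?c (real j / real m) ^ N + M * r ^ N)"
    proof (rule sum_mono)
      fix j assume "j \<in> {..<m}"
      then have j: "j / m \<in> {0..1}" by auto
      show "?c (real j / real m) ^ N * g (real j / real m) \<le> \<epsilon> / 2 * ?c (real j / real m) ^ N + M * r ^ N"
      proof (cases "j / m \<in> K")
        case True
        have "?c (real j / real m) ^ N * g (real j / real m) \<le> r ^ N * M"
          using True r raised_cosine_nonneg M j \<open>\<epsilon> > 0\<close>
          by (intro mult_mono power_mono) (auto simp: K_def)
        moreover have "0 \<le> \<epsilon> / 2 * ?c (real j / real m) ^ N"
          using \<open>\<epsilon> > 0\<close> raised_cosine_nonneg by simp
        ultimately show ?thesis by (simp add: mult.commute)
      next
        case False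
        then have "g (real j / real m) \<le> \<epsilon> / 2" using j by (auto simp: K_def)
        then have "?c (real j / real m) ^ N * g (real j / real m) \<le> ?c (real j / real m) ^ N * (\<epsilon> / 2)"
          using raised_cosine_nonneg by (intro mult_left_mono) auto
        moreover have "0 \<le> M * r ^ N" using M r by simp
        ultimately show ?thesis by (simp add: mult.commute)
      qed
    qed
    also have "\<dots> = \<epsilon> / 2 * (\<Sum>j<m. ?c (real j / real m) ^ N) + real m * (M * r ^ N)"
      by (simp add: sum.distrib sum_distrib_left)
    also have "real m * (M * r ^ N) \<le> \<epsilon> / 2 * (\<eta> * \<rho> ^ N * real m)"
      using mult_left_mono[OF N, of "real m"] by (simp add: mult_ac)
    also have "\<dots> \<le> \<epsilon> / 2 * (\<Sum>j<m. ?c (real j / real m) ^ N)"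
      using lower[of N m] \<open>\<epsilon> > 0\<close> by (intro mult_left_mono) auto
    finally show ?thesis by (simp add: field_simps)
  qed
  show ?thesis
    by (rule that[of "\<eta> * \<rho> ^ N" N]) (use \<eta> \<rho> lower upper in auto)
qed

section \<open>Convergence and continuity in terms of seminorms\<close>

context hausdorff_lcs
begin

lemma
  assumes "p \<in> \<Gamma>"
  shows seminorm_nonneg [simp]: "0 \<le> p x"
    and seminorm_triangle: "p (x + y) \<le> p x + p y"
    and seminorm_scale: "p (smul c x) = cmod c * p x"
    and seminorm_zero: "p 0 = 0"
proof -
  note p = seminorms[OF assms, unfolded seminorm_on_def]
  show "0 \<le> p x" "p (x + y) \<le> p x + p y" and scale: "p (smul c x) = cmod c * p x" for c x y
    using p by auto
  show "p 0 = 0" using scale[of 0 0] by simp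
qed

lemma seminorm_minus: "p \<in> \<Gamma> \<Longrightarrow> p (- x) = p x"
  using seminorm_scale[of p "-1" x] by (simp add: scale_minus_left)

lemma seminorm_commute: "p \<in> \<Gamma> \<Longrightarrow> p (x - y) = p (y - x)"
  using seminorm_minus[of p "x - y"] by simp

lemma seminorm_triangle_via: "p \<in> \<Gamma> \<Longrightarrow> p (x - z) \<le> p (x - y) + p (y - z)"
  using seminorm_triangle[of p "x - y" "y - z"] by simp

lemma seminorm_reverse_triangle: "p \<in> \<Gamma> \<Longrightarrow> \<bar>p x - p y\<bar> \<le> p (x - y)"
  using seminorm_triangle[of p "x - y" y] seminorm_triangle[of p "y - x" x] seminorm_commute[of p x y] by auto

lemma seminorm_sum: "p \<in> \<Gamma> \<Longrightarrow> p (\<Sum>i\<in>A. f i) \<le> (\<Sum>i\<in>A. p (f i))"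
proof (induction A rule: infinite_finite_induct)
  case (insert a A)
  then show ?case using seminorm_triangle[of p "f a" "sum f A"] by simp
qed (auto simp: seminorm_zero)

lemma open_seminorm_ball: "p \<in> \<Gamma> \<Longrightarrow> open {y. p (y - x) < \<epsilon>}"
  unfolding open_iff
proof
  fix y assume p: "p \<in> \<Gamma>" and y: "y \<in> {y. p (y - x) < \<epsilon>}"
  have "{z. \<forall>q\<in>{p}. q (z - y) < \<epsilon> - p (y - x)} \<subseteq> {y. p (y - x) < \<epsilon>}"
  proof
    fix z assume "z \<in> {z. \<forall>q\<in>{p}. q (z - y) < \<epsilon> - p (y - x)}"
    then show "z \<in> {y. p (y - x) < \<epsilon>}" using seminorm_triangle_via[OF p, of z x y] by auto
  qed
  then show "\<exists>F \<delta>. finite F \<and> F \<subseteq> \<Gamma> \<and> 0 < \<delta> \<and> {z. \<forall>q\<in>F. q (z - y) < \<delta>} \<subseteq> {y. p (y - x) < \<epsilon>}"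
    using p y by (intro exI[of _ "{p}"] exI[of _ "\<epsilon> - p (y - x)"]) auto
qed

lemma tendsto_iff_seminorms:
  "(f \<longlongrightarrow> l) F \<longleftrightarrow> (\<forall>p\<in>\<Gamma>. ((\<lambda>i. p (f i - l)) \<longlongrightarrow> 0) F)"
proof
  assume f: "(f \<longlongrightarrow> l) F"
  show "\<forall>p\<in>\<Gamma>. ((\<lambda>i. p (f i - l)) \<longlongrightarrow> 0) F"
  proof
    fix p assume p: "p \<in> \<Gamma>"
    show "((\<lambda>i. p (f i - l)) \<longlongrightarrow> 0) F"
    proof (rule tendstoI)
      fix e :: real assume "e > 0"
      then have "eventually (\<lambda>i. f i \<in> {y. p (y - l) < e}) F"
        using topological_tendstoD[OF f open_seminorm_ball[OF p]] seminorm_zero[OF p] by simp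
      then show "eventually (\<lambda>i. dist (p (f i - l)) 0 < e) F"
        using p by (simp add: dist_real_def)
    qed
  qed
next
  assume p: "\<forall>p\<in>\<Gamma>. ((\<lambda>i. p (f i - l)) \<longlongrightarrow> 0) F"
  show "(f \<longlongrightarrow> l) F"
  proof (rule topological_tendstoI)
    fix U assume "open U" "l \<in> U"
    then obtain S e where S: "finite S" "S \<subseteq> \<Gamma>" "0 < e" "{y. \<forall>p\<in>S. p (y - l) < e} \<subseteq> U"
      unfolding open_iff by meson
    have "eventually (\<lambda>i. \<forall>p\<in>S. p (f i - l) < e) F"
      using S(1) by (rule eventually_ball_finite) (use S p order_tendstoD(2) in blast)
    then show "eventually (\<lambda>i. f i \<in> U) F"
      by (rule eventually_mono) (use S(4) in auto)
  qed
qed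

lemma tendsto_seminorm:
  "p \<in> \<Gamma> \<Longrightarrow> (f \<longlongrightarrow> l) F \<Longrightarrow> ((\<lambda>i. p (f i - l)) \<longlongrightarrow> 0) F"
  using tendsto_iff_seminorms by blast

text \<open>
  The type class provides a topology and a group structure, but no relation between them: that the
  vector space operations are continuous is a consequence of the description by seminorms.
\<close>

lemma tendsto_smul:
  assumes c: "(c \<longlongrightarrow> c0) F" and f: "(f \<longlongrightarrow> l) F"
  shows "((\<lambda>i. smul (c i) (f i)) \<longlongrightarrow> smul c0 l) F"
  unfolding tendsto_iff_seminorms
proof
  fix p assume p: "p \<in> \<Gamma>"
  have "((\<lambda>i. p (f i - l)) \<longlongrightarrow> 0) F" using tendsto_seminorm[OF p f] .
  then have "((\<lambda>i. cmod (c i) * p (f i - l) + cmod (c i - c0) * p l) \<longlongrightarrow>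
      cmod c0 * 0 + cmod (c0 - c0) * p l) F"
    by (intro tendsto_intros c)
  then have lim: "((\<lambda>i. cmod (c i) * p (f i - l) + cmod (c i - c0) * p l) \<longlongrightarrow> 0) F" by simp
  show "((\<lambda>i. p (smul (c i) (f i) - smul c0 l)) \<longlongrightarrow> 0) F"
  proof (rule tendsto_sandwich[OF _ _ tendsto_const lim])
    show "eventually (\<lambda>i. p (smul (c i) (f i) - smul c0 l)
        \<le> cmod (c i) * p (f i - l) + cmod (c i - c0) * p l) F"
    proof (intro always_eventually allI)
      fix i
      have "smul (c i) (f i) - smul c0 l = smul (c i) (f i - l) + smul (c i - c0) l"
        by (simp add: scale_right_diff_distrib scale_left_diff_distrib)
      then show "p (smul (c i) (f i) - smul c0 l)
        \<le> cmod (c i) * p (f i - l) + cmod (c i - c0) * p l"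
        using seminorm_triangle[OF p] seminorm_scale[OF p] by metis
    qed
  qed (use p in simp)
qed

lemma tendsto_plus:
  fixes f g :: "'i \<Rightarrow> 'a"
  assumes f: "(f \<longlongrightarrow> a) F" and g: "(g \<longlongrightarrow> b) F"
  shows "((\<lambda>i. f i + g i) \<longlongrightarrow> a + b) F"
  unfolding tendsto_iff_seminorms
proof
  fix p assume p: "p \<in> \<Gamma>"
  have lim: "((\<lambda>i. p (f i - a) + p (g i - b)) \<longlongrightarrow> 0) F"
    using tendsto_add[OF tendsto_seminorm[OF p f] tendsto_seminorm[OF p g]] by simp
  show "((\<lambda>i. p (f i + g i - (a + b))) \<longlongrightarrow> 0) F"
  proof (rule tendsto_sandwich[OF _ _ tendsto_const lim])
    show "eventually (\<lambda>i. p (f i + g i - (a + b)) \<le> p (f i - a) + p (g i - b)) F"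
      using seminorm_triangle[OF p, of "f _ - a" "g _ - b"]
      by (intro always_eventually allI) (simp add: algebra_simps)
  qed (use p in simp)
qed

lemma continuous_on_seminorm_dist:
  assumes "p \<in> \<Gamma>" "continuous_on A f"
  shows "continuous_on A (\<lambda>s. p (f s - x))"
  unfolding continuous_on_def
proof
  fix a assume "a \<in> A"
  then have "(f \<longlongrightarrow> f a) (at a within A)" using assms(2) by (simp add: continuous_on_def)
  then have lim: "((\<lambda>s. p (f s - f a)) \<longlongrightarrow> 0) (at a within A)"
    by (rule tendsto_seminorm[OF assms(1)])
  have "((\<lambda>s. p (f s - x) - p (f a - x)) \<longlongrightarrow> 0) (at a within A)"
  proof (rule Lim_null_comparison[OF always_eventually lim], rule allI)
    fix s show "norm (p (f s - x) - p (f a - x)) \<le> p (f s - f a)"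
      using seminorm_reverse_triangle[OF assms(1), of "f s - x" "f a - x"] by simp
  qed
  then show "((\<lambda>s. p (f s - x)) \<longlongrightarrow> p (f a - x)) (at a within A)"
    by (rule LIM_zero_cancel)
qed

text \<open>
  A neighbourhood of \<open>x\<close> is cut out by finitely many seminorms. Their sum is a continuous seminorm,
  hence dominated by a single member of the fundamental system, and it is enough to approximate \<open>x\<close>
  with respect to one seminorm at a time.
\<close>

lemma closure_by_seminorms:
  assumes "\<And>p \<epsilon>. p \<in> \<Gamma> \<Longrightarrow> \<epsilon> > 0 \<Longrightarrow> \<exists>y\<in>S. p (y - x) < \<epsilon>"
  shows "x \<in> closure S"
  unfolding closure_iff_nhds_not_empty
proof (intro allI impI)
  fix A U assume "x \<in> U" "open U" "U \<subseteq> A"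
  then obtain F e where F: "finite F" "F \<subseteq> \<Gamma>" "0 < e" "{y. \<forall>p\<in>F. p (y - x) < e} \<subseteq> U"
    unfolding open_iff by meson
  define q where "q x = (\<Sum>p\<in>F. p x)" for x
  have "seminorm_on smul q"
    using F(2) seminorm_triangle seminorm_nonneg seminorm_scale unfolding seminorm_on_def q_def
    by (auto simp: subset_iff sum_distrib_left simp flip: sum.distrib
        intro!: sum_nonneg sum_mono sum.cong)
  moreover have "continuous_on UNIV q"
  proof -
    have "continuous_on UNIV p" if "p \<in> F" for p
      using continuous_on_seminorm_dist[of p UNIV id 0] that F(2) by auto
    then show ?thesis unfolding q_def by (intro continuous_on_sum) auto
  qed
  ultimately obtain p C where p: "p \<in> \<Gamma>" "C \<ge> 0" "\<And>x. q x \<le> C * p x"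
    using fundamental by blast
  \<comment> \<open>\<open>C + 1\<close> instead of \<open>C\<close>, since \<open>C\<close> may be \<open>0\<close>.\<close>
  obtain y where y: "y \<in> S" "p (y - x) < e / (C + 1)"
    using assms[OF p(1), of "e / (C + 1)"] F(3) p(2) by auto
  have "y \<in> {y. \<forall>p\<in>F. p (y - x) < e}"
  proof (rule CollectI, rule ballI)
    fix p' assume "p' \<in> F"
    then have "p' (y - x) \<le> q (y - x)"
      unfolding q_def using F by (intro member_le_sum) (auto simp: subset_iff)
    also have "\<dots> \<le> (C + 1) * p (y - x)" 
      using p(3)[of "y - x"] seminorm_nonneg[OF p(1), of "y - x"] unfolding distrib_right by linarith
    also have "\<dots> < e" using y(2) p(2) by (simp add: field_simps)
    finally show "p' (y - x) < e" .
  qed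
  then show "S \<inter> A \<noteq> {}" using y(1) F(4) \<open>U \<subseteq> A\<close> by auto
qed

text \<open>
  The type carries no uniform structure. Instead, the real function \<open>(s, t) \<mapsto> p (h s - h t)\<close> is
  uniformly continuous on the compact square and vanishes on the diagonal.
\<close>

lemma uniformly_continuous_seminorm:
  fixes h :: "real \<Rightarrow> 'a"
  assumes p: "p \<in> \<Gamma>" and h: "continuous_on {a..b} h" and "\<epsilon> > 0"
  obtains \<delta> where "\<delta> > 0"
    and "\<And>s t. s \<in> {a..b} \<Longrightarrow> t \<in> {a..b} \<Longrightarrow> \<bar>s - t\<bar> < \<delta> \<Longrightarrow> p (h s - h t) < \<epsilon>"
proof -
  let ?Q = "{a..b} \<times> {a..b}"
  define G where "G z = p (h (fst z) - h (snd z))" for z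
  have "continuous_on ?Q G"
    unfolding continuous_on_def
  proof
    fix z assume z: "z \<in> ?Q"
    have fst: "((\<lambda>w. h (fst w)) \<longlongrightarrow> h (fst z)) (at z within ?Q)"
      using z by (intro continuous_on_tendsto_compose[OF h] tendsto_intros)
        (auto simp: eventually_at_filter intro!: always_eventually)
    have snd: "((\<lambda>w. h (snd w)) \<longlongrightarrow> h (snd z)) (at z within ?Q)"
      using z by (intro continuous_on_tendsto_compose[OF h] tendsto_intros)
        (auto simp: eventually_at_filter intro!: always_eventually)
    have lim: "((\<lambda>w. p (h (fst w) - h (fst z)) + p (h (snd w) - h (snd z))) \<longlongrightarrow> 0)
        (at z within ?Q)"
      using tendsto_add[OF tendsto_seminorm[OF p fst] tendsto_seminorm[OF p snd]] by simp
    have "((\<lambda>w. G w - G z) \<longlongrightarrow> 0) (at z within ?Q)"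
    proof (rule Lim_null_comparison[OF always_eventually lim], rule allI)
      fix w
      show "norm (G w - G z) \<le> p (h (fst w) - h (fst z)) + p (h (snd w) - h (snd z))"
        using seminorm_reverse_triangle[OF p, of "h (fst w) - h (snd w)" "h (fst z) - h (snd z)"]
          seminorm_triangle[OF p, of "h (fst w) - h (fst z)" "h (snd z) - h (snd w)"]
          seminorm_commute[OF p, of "h (snd z)" "h (snd w)"]
        by (simp add: G_def algebra_simps)
    qed
    then show "(G \<longlongrightarrow> G z) (at z within ?Q)" by (rule LIM_zero_cancel)
  qed
  then have "uniformly_continuous_on ?Q G"
    by (intro compact_uniformly_continuous compact_Times) auto
  then obtain \<delta> where \<delta>: "\<delta> > 0"
    "\<And>z w. z \<in> ?Q \<Longrightarrow> w \<in> ?Q \<Longrightarrow> dist w z < \<delta> \<Longrightarrow> dist (G w) (G z) < \<epsilon>"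
    unfolding uniformly_continuous_on_def using \<open>\<epsilon> > 0\<close> by meson
  show ?thesis
  proof (rule that[OF \<delta>(1)])
    fix s t assume st: "s \<in> {a..b}" "t \<in> {a..b}" "\<bar>s - t\<bar> < \<delta>"
    then show "p (h s - h t) < \<epsilon>"
      using \<delta>(2)[of "(t, t)" "(s, t)"] seminorm_zero[OF p] by (auto simp: G_def dist_Pair_Pair dist_real_def)
  qed
qed

section \<open>Riemann sums of vector-valued functions\<close>

definition mean :: "nat \<Rightarrow> (nat \<Rightarrow> 'a) \<Rightarrow> 'a" where
  "mean n f = smul (1 / of_nat n) (\<Sum>j<n. f j)"

lemma mean_diff_bound:
  assumes "p \<in> \<Gamma>" "0 \<le> \<epsilon>" "\<And>j. j < n \<Longrightarrow> p (f j - g j) \<le> \<epsilon>"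
  shows "p (mean n f - mean n g) \<le> \<epsilon>"
proof (cases "n = 0")
  case False
  have "mean n f - mean n g = smul (1 / of_nat n) (\<Sum>j<n. f j - g j)"
    by (simp add: mean_def sum_subtractf scale_right_diff_distrib)
  then have "p (mean n f - mean n g) = p (\<Sum>j<n. f j - g j) / n"
    using seminorm_scale[OF assms(1)] by (simp add: norm_divide)
  also have "\<dots> \<le> (\<Sum>j<n. p (f j - g j)) / n"
    by (intro divide_right_mono seminorm_sum assms(1)) auto
  also have "\<dots> \<le> (\<Sum>j<n. \<epsilon>) / n"
    using assms(3) by (intro divide_right_mono sum_mono) auto
  finally show ?thesis using False by simp
qed (use assms in \<open>simp add: mean_def seminorm_zero\<close>)

lemma mean_refine:
  assumes "k > 0"
  shows "mean (n * k) (\<lambda>j. f (j div k)) = mean n f"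
proof -
  have "(\<Sum>j<n * k. f (j div k)) = (\<Sum>i<n. \<Sum>j\<in>{i * k..<i * k + k}. f (j div k))"
    by (rule sum.nat_group[symmetric])
  also have "\<dots> = (\<Sum>i<n. \<Sum>j\<in>{i * k..<i * k + k}. f i)"
  proof (intro sum.cong refl)
    fix i j assume "j \<in> {i * k..<i * k + k}"
    then have "j div k = i" by (intro div_nat_eqI) (auto simp: mult.commute)
    then show "f (j div k) = f i" by simp
  qed
  also have "\<dots> = smul (of_nat k) (\<Sum>i<n. f i)"
    by (simp add: sum_constant_scale scale_sum_right)
  finally show ?thesis using assms by (simp add: mean_def)
qed

text \<open>
  The sums for \<open>n\<close> and \<open>m\<close> points are compared through the common refinement with \<open>n * m\<close> points:
  a grid point of the refinement has distance less than \<open>1 / n\<close> from the coarse grid point below it.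
\<close>

lemma riemann_sums_cauchy:
  assumes h: "continuous_on {0..1} h"
  shows "cauchy_seq (\<lambda>n. mean n (\<lambda>j. h (real j / real n)))"
  unfolding cauchy_seq_def
proof (intro allI impI)
  fix U :: "'a set" assume "open U \<and> 0 \<in> U"
  then obtain F e where F: "finite F" "F \<subseteq> \<Gamma>" "0 < e" "{y. \<forall>p\<in>F. p (y - 0) < e} \<subseteq> U"
    unfolding open_iff by meson
  let ?R = "\<lambda>n. mean n (\<lambda>j. h (real j / real n))"
  have "eventually (\<lambda>n. \<forall>p\<in>F. \<forall>k>0. p (?R n - ?R (n * k)) \<le> e / 3) sequentially"
    using F(1)
  proof (rule eventually_ball_finite, intro ballI)
    fix p assume "p \<in> F"
    then have p: "p \<in> \<Gamma>" using F by auto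
    obtain \<delta> where \<delta>: "\<delta> > 0"
      "\<And>s t. s \<in> {0..1} \<Longrightarrow> t \<in> {0..1} \<Longrightarrow> \<bar>s - t\<bar> < \<delta> \<Longrightarrow> p (h s - h t) < e / 3"
      using uniformly_continuous_seminorm[OF p h, of "e / 3"] F(3) by auto
    obtain N :: nat where N: "1 / \<delta> < N" using reals_Archimedean2 by blast
    show "eventually (\<lambda>n. \<forall>k>0. p (?R n - ?R (n * k)) \<le> e / 3) sequentially"
    proof (rule eventually_sequentiallyI[of "Suc N"], intro allI impI)
      fix n k :: nat assume n: "Suc N \<le> n" and "k > 0"
      have "1 / \<delta> < n" using N n by linarith
      then have n\<delta>: "1 / n < \<delta>" using n \<delta>(1) by (simp add: field_simps)
      have "p (h (real (j div k) / n) - h (real j / real (n * k))) \<le> e / 3" if "j < n * k" for j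
      proof (rule less_imp_le, rule \<delta>(2))
        have div: "j div k < n" using that by (simp add: less_mult_imp_div_less)
        have eq: "real j / real (n * k) = (real (j div k) + real (j mod k) / k) / n"
        proof -
          have "real j = real (j div k) * k + real (j mod k)"
            by (metis div_mult_mod_eq of_nat_add of_nat_mult)
          then show ?thesis using \<open>k > 0\<close> n by (simp add: field_simps)
        qed
        have mod: "0 \<le> real (j mod k) / k" "real (j mod k) / k < 1" using \<open>k > 0\<close> by auto
        show "real (j div k) / n \<in> {0..1}" using div by auto
        have "real j / real (n * k) \<le> 1" using that by (subst divide_le_eq_1_pos) linarith+
        then show "real j / real (n * k) \<in> {0..1}" by (simp del: of_nat_mult)
        have "\<bar>real (j div k) / n - real j / real (n * k)\<bar> = (real (j mod k) / k) / n"
          unfolding eq add_divide_distrib by simp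
        also have "\<dots> \<le> 1 / n" using mod by (intro divide_right_mono) auto
        finally show "\<bar>real (j div k) / n - real j / real (n * k)\<bar> < \<delta>" using n\<delta> by linarith
      qed
      then have "p (mean (n * k) (\<lambda>j. h (real (j div k) / n)) - ?R (n * k)) \<le> e / 3"
        using F(3) by (intro mean_diff_bound[OF p]) auto
      then show "p (?R n - ?R (n * k)) \<le> e / 3"
        using mean_refine[OF \<open>k > 0\<close>, of n "\<lambda>j. h (real j / n)"] by simp
    qed
  qed
  then obtain N where N: "\<And>n p k. N \<le> n \<Longrightarrow> p \<in> F \<Longrightarrow> k > 0 \<Longrightarrow> p (?R n - ?R (n * k)) \<le> e / 3"
    unfolding eventually_sequentially by metis
  have "?R m - ?R n \<in> U" if mn: "Suc N \<le> m" "Suc N \<le> n" for m n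
  proof -
    have "p (?R m - ?R n - 0) < e" if "p \<in> F" for p
    proof -
      have p: "p \<in> \<Gamma>" using that F by auto
      have "p (?R m - ?R n) \<le> p (?R m - ?R (m * n)) + p (?R (n * m) - ?R n)"
        using seminorm_triangle_via[OF p, of "?R m" "?R n" "?R (m * n)"] by (simp only: mult.commute)
      also have "\<dots> \<le> e / 3 + e / 3"
        using N[of m p n] N[of n p m] that mn seminorm_commute[OF p, of "?R n" "?R (n * m)"]
        by (intro add_mono) auto
      finally show ?thesis using F(3) by simp
    qed
    then show ?thesis using F(4) by blast
  qed
  then show "\<exists>N. \<forall>m\<ge>N. \<forall>n\<ge>N. ?R m - ?R n \<in> U" by blast
qed

text \<open>
  By periodicity, a shift by a multiple \<open>m / n\<close> of the mesh size does not change the sum. The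
  remaining shift \<open>r - m / n\<close> is shorter than the mesh size, so that uniform continuity applies.
\<close>

lemma riemann_sums_shift:
  assumes h: "continuous_on {0..} h" and per: "\<And>s. 0 \<le> s \<Longrightarrow> h (s + 1) = h s" and "0 \<le> r"
    and lim: "(\<lambda>n. mean n (\<lambda>j. h (real j / real n))) \<longlonglongrightarrow> y"
  shows "(\<lambda>n. mean n (\<lambda>j. h (real j / real n + r))) \<longlonglongrightarrow> y"
proof -
  have shift: "mean n (\<lambda>j. h (real (j + m) / real n)) = mean n (\<lambda>j. h (real j / real n))" for n m
  proof (cases "n = 0")
    case False
    have "(\<Sum>j<n. h (real (j + m) / n)) = (\<Sum>j<n. h (real j / n))"
    proof (induction m)
      case (Suc m)
      have "(\<Sum>j<n. h (real (j + Suc m) / n)) + h (real m / n) = (\<Sum>j<Suc n. h (real (j + m) / n))"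
        by (subst sum.lessThan_Suc_shift) (simp add: add.commute)
      also have "\<dots> = (\<Sum>j<n. h (real (j + m) / n)) + h (real m / n)"
        using per[of "real m / n"] False by (simp add: add_divide_distrib add.commute)
      finally show ?case using Suc by simp
    qed simp
    then show ?thesis by (simp add: mean_def)
  qed (simp add: mean_def)
  show ?thesis
    unfolding tendsto_iff_seminorms
  proof
    fix p assume p: "p \<in> \<Gamma>"
    let ?S = "\<lambda>n. mean n (\<lambda>j. h (real j / real n + r))"
    let ?R = "\<lambda>n. mean n (\<lambda>j. h (real j / real n))"
    have "(\<lambda>n. p (?S n - ?R n)) \<longlonglongrightarrow> 0"
    proof (rule tendstoI)
      fix e :: real assume "e > 0"
      have "continuous_on {0..1 + r} h" by (rule continuous_on_subset[OF h]) auto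
      then obtain \<delta> where \<delta>: "\<delta> > 0"
        "\<And>s t. s \<in> {0..1 + r} \<Longrightarrow> t \<in> {0..1 + r} \<Longrightarrow> \<bar>s - t\<bar> < \<delta> \<Longrightarrow> p (h s - h t) < e / 2"
        using uniformly_continuous_seminorm[OF p, of 0 "1 + r" h "e / 2"] \<open>e > 0\<close> by auto
      obtain N :: nat where N: "1 / \<delta> < N" using reals_Archimedean2 by blast
      show "eventually (\<lambda>n. dist (p (?S n - ?R n)) 0 < e) sequentially"
      proof (rule eventually_sequentiallyI[of "Suc N"])
        fix n assume n: "Suc N \<le> n"
        have "1 / \<delta> < n" using N n by linarith
        then have n\<delta>: "1 / n < \<delta>" using n \<delta>(1) by (simp add: field_simps)
        define m where "m = nat \<lfloor>r * n\<rfloor>"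
        have "real m \<le> r * n" "r * n < real m + 1"
          using \<open>0 \<le> r\<close> by (auto simp: m_def)
        then have "real m / n \<le> r" "r < (real m + 1) / n"
          using n by (simp_all add: divide_le_eq less_divide_eq)
        then have m: "real m / n \<le> r" "r - real m / n < 1 / n"
          by (simp_all add: add_divide_distrib)
        have "p (h (real j / n + r) - h (real (j + m) / n)) \<le> e / 2" if "j < n" for j
        proof (rule less_imp_le, rule \<delta>(2))
          have j: "real j / n \<le> 1" using that by simp
          have eq: "real (j + m) / n = real j / n + real m / n" by (simp add: add_divide_distrib)
          show "real j / n + r \<in> {0..1 + r}" using j \<open>0 \<le> r\<close> by simp
          show "real (j + m) / n \<in> {0..1 + r}" unfolding eq using j m(1) by simp
          show "\<bar>real j / n + r - real (j + m) / n\<bar> < \<delta>" unfolding eq using m n\<delta> by linarith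
        qed
        then have "p (?S n - mean n (\<lambda>j. h (real (j + m) / n))) \<le> e / 2"
          using \<open>e > 0\<close> by (intro mean_diff_bound[OF p]) auto
        then show "dist (p (?S n - ?R n)) 0 < e"
          using \<open>e > 0\<close> p unfolding shift by (simp add: dist_real_def)
      qed
    qed
    from tendsto_add[OF this tendsto_seminorm[OF p lim]]
    have lim0: "(\<lambda>n. p (?S n - ?R n) + p (?R n - y)) \<longlonglongrightarrow> 0" by simp
    show "(\<lambda>n. p (?S n - y)) \<longlonglongrightarrow> 0"
      by (rule tendsto_sandwich[OF _ _ tendsto_const lim0])
        (use p seminorm_triangle_via[OF p] in \<open>auto intro!: always_eventually\<close>)
  qed
qed

lemma eq_zero_if_seminorms_zero:
  assumes "\<And>p. p \<in> \<Gamma> \<Longrightarrow> p x = 0"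
  shows "x = 0"
proof -
  have "(\<lambda>_::nat. x) \<longlonglongrightarrow> 0"
    unfolding tendsto_iff_seminorms by (auto simp: assms)
  then show ?thesis by (simp add: LIMSEQ_const_iff)
qed

section \<open>Approximation by Fourier coefficients\<close>

lemma mean_smul: "smul c (mean n f) = mean n (\<lambda>j. smul c (f j))"
  by (simp add: mean_def scale_sum_right mult.commute)

lemma mean_plus: "mean n f + mean n g = mean n (\<lambda>j. f j + g j)"
  by (simp add: mean_def sum.distrib scale_right_distrib)

lemma mean_linear:
  assumes "Vector_Spaces.linear smul smul S"
  shows "S (mean n f) = mean n (\<lambda>j. S (f j))"
proof -
  interpret S: Vector_Spaces.linear smul smul S by fact
  show ?thesis by (simp add: mean_def S.scale S.sum)
qed

definition character :: "int \<Rightarrow> real \<Rightarrow> complex" where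
  "character k s = exp (2 * of_real pi * \<i> * of_int k * of_real s)"

lemma character_add: "character (k + l) s = character k s * character l s"
  by (simp add: character_def ring_distribs flip: exp_add)

lemma raised_cosine_characters:
  "complex_of_real (raised_cosine s) = 1 / 2 + character 1 s / 4 + character (-1) s / 4"
  by (simp add: raised_cosine_def character_def cos_exp_eq field_simps flip: cos_of_real)

text \<open>
  The weight \<open>raised_cosine ^ N\<close> is a trigonometric polynomial. Carrying an arbitrary character \<open>k\<close>
  along makes the induction on \<open>N\<close> work without binomial coefficients, since one more factor only
  shifts \<open>k\<close> by \<open>0\<close>, \<open>1\<close> or \<open>-1\<close>.
\<close>

lemma raised_cosine_weighted_limit:
  assumes V: "module.subspace smul V"
    and coeff: "\<And>k. \<exists>y\<in>V. (\<lambda>n. mean n (\<lambda>j. smul (character k (j / n)) (f (j / n)))) \<longlonglongrightarrow> y"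
  shows "\<exists>y\<in>V. (\<lambda>n. mean n (\<lambda>j.
      smul (character k (j / n) * of_real (raised_cosine (j / n) ^ N)) (f (j / n)))) \<longlonglongrightarrow> y"
proof (induction N arbitrary: k)
  case 0
  then show ?case using coeff by simp
next
  case (Suc N)
  let ?w = "\<lambda>k s. character k s * of_real (raised_cosine s ^ N)"
  let ?R = "\<lambda>k n. mean n (\<lambda>j. smul (?w k (real j / real n)) (f (real j / real n)))"
  obtain a b c where abc: "a \<in> V" "b \<in> V" "c \<in> V"
    and lim: "?R k \<longlonglongrightarrow> a" "?R (k + 1) \<longlonglongrightarrow> b" "?R (k + (-1)) \<longlonglongrightarrow> c"
    using Suc.IH by meson
  have "character k s * of_real (raised_cosine s ^ Suc N)
      = 1 / 2 * ?w k s + (1 / 4 * ?w (k + 1) s + 1 / 4 * ?w (k + (-1)) s)" for s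
    unfolding character_add power_Suc of_real_mult raised_cosine_characters
    by (simp add: field_simps)
  then have "mean n (\<lambda>j. smul (character k (real j / real n) *
        of_real (raised_cosine (real j / real n) ^ Suc N)) (f (real j / real n)))
      = smul (1 / 2) (?R k n) + (smul (1 / 4) (?R (k + 1) n) + smul (1 / 4) (?R (k + (-1)) n))" for n
    by (simp only: mean_smul mean_plus scale_scale scale_left_distrib)
  moreover have "(\<lambda>n. smul (1 / 2) (?R k n) + (smul (1 / 4) (?R (k + 1) n) + smul (1 / 4) (?R (k + (-1)) n)))
      \<longlonglongrightarrow> smul (1 / 2) a + (smul (1 / 4) b + smul (1 / 4) c)"
    by (intro tendsto_plus tendsto_smul tendsto_const lim)
  moreover have "smul (1 / 2) a + (smul (1 / 4) b + smul (1 / 4) c) \<in> V"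
    using abc V by (intro subspace_add subspace_scale) auto
  ultimately show ?case by auto
qed

text \<open>
  With respect to a single seminorm, the normalised weighted means of \<open>f\<close> are close to \<open>x = f 0\<close>,
  uniformly in the grid, because the weights concentrate where \<open>p (f s - x)\<close> is small. The limit \<open>y\<close>
  of the unnormalised means belongs to \<open>V\<close>, and so does \<open>y / d\<close> with the weight \<open>d\<close> of any single
  grid. For a grid fine enough that the mean is close to \<open>y\<close>, this quotient is close to \<open>x\<close>.
\<close>

lemma value_in_closure_of_fourier_coefficients:
  assumes V: "module.subspace smul V"
    and f: "continuous_on {0..1} f" "f 0 = x" "f 1 = x"
    and coeff: "\<And>k. \<exists>y\<in>V. (\<lambda>n. mean n (\<lambda>j. smul (character k (j / n)) (f (j / n)))) \<longlonglongrightarrow> y"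
  shows "x \<in> closure V"
proof (rule closure_by_seminorms)
  fix p and \<epsilon> :: real assume p: "p \<in> \<Gamma>" and "\<epsilon> > 0"
  let ?c = raised_cosine
  have g: "continuous_on {0..1} (\<lambda>s. p (f s - x))" by (rule continuous_on_seminorm_dist[OF p f(1)])
  have g0: "p (f 0 - x) = 0" "p (f 1 - x) = 0" and half: "\<epsilon> / 2 > 0"
    using f \<open>\<epsilon> > 0\<close> seminorm_zero[OF p] by simp_all
  obtain N \<kappa> where \<kappa>: "\<kappa> > 0"
    and lower: "\<And>m. \<kappa> * real m \<le> (\<Sum>j<m. ?c (real j / real m) ^ N)"
    and upper: "\<And>m. (\<Sum>j<m. ?c (real j / real m) ^ N * p (f (real j / real m) - x))
              \<le> \<epsilon> / 2 * (\<Sum>j<m. ?c (real j / real m) ^ N)"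
    by (rule raised_cosine_concentrates[OF g g0 half]) (rule that)
  let ?Y = "\<lambda>n. mean n (\<lambda>j. smul (of_real (?c (real j / real n) ^ N)) (f (real j / real n)))"
  have "character 0 s = 1" for s by (simp add: character_def)
  then have "\<exists>y\<in>V. ?Y \<longlonglongrightarrow> y"
    using raised_cosine_weighted_limit[OF V coeff, of 0 N] by (simp only: mult_1_left)
  then obtain y where y: "y \<in> V" "?Y \<longlonglongrightarrow> y" by blast
  have "eventually (\<lambda>n. p (?Y n - y) < \<epsilon> / 2 * \<kappa>) sequentially"
    by (rule order_tendstoD(2)[OF tendsto_seminorm[OF p y(2)]]) (use \<kappa> \<open>\<epsilon> > 0\<close> in auto)
  then obtain M where M: "\<And>n. M \<le> n \<Longrightarrow> p (?Y n - y) < \<epsilon> / 2 * \<kappa>"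
    unfolding eventually_sequentially by blast
  define n where "n = Suc M"
  have n: "n > 0" "p (?Y n - y) < \<epsilon> / 2 * \<kappa>" using M[of n] by (simp_all add: n_def)
  \<comment> \<open>The weight of this one grid serves as the normalising constant; \<open>\<kappa> \<le> d\<close> keeps the division
    under control.\<close>
  define d where "d = (\<Sum>j<n. ?c (real j / real n) ^ N) / n"
  have d: "\<kappa> \<le> d" using lower[of n] n(1) by (simp add: d_def field_simps)
  then have "d > 0" using \<kappa> by simp
  have "?Y n - smul (of_real d) x
      = smul (1 / of_nat n) (\<Sum>j<n. smul (of_real (?c (real j / real n) ^ N)) (f (real j / real n) - x))"
    by (simp add: mean_def d_def scale_right_diff_distrib sum_subtractf scale_sum_left
        scale_sum_right sum_divide_distrib)
  then have "p (?Y n - smul (of_real d) x)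
      = p (\<Sum>j<n. smul (of_real (?c (real j / real n) ^ N)) (f (real j / real n) - x)) / n"
    using seminorm_scale[OF p] by (simp add: norm_divide)
  also have "\<dots> \<le> (\<Sum>j<n. p (smul (of_real (?c (real j / real n) ^ N)) (f (real j / real n) - x))) / n"
    by (intro divide_right_mono seminorm_sum p) auto
  also have "\<dots> = (\<Sum>j<n. ?c (real j / real n) ^ N * p (f (real j / real n) - x)) / n"
    using raised_cosine_nonneg by (simp add: seminorm_scale[OF p] norm_power flip: of_real_power)
  also have "\<dots> \<le> \<epsilon> / 2 * (\<Sum>j<n. ?c (real j / real n) ^ N) / n"
    by (intro divide_right_mono upper) auto
  finally have "p (?Y n - smul (of_real d) x) \<le> \<epsilon> / 2 * d" by (simp add: d_def)
  moreover have "p (?Y n - y) < \<epsilon> / 2 * d"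
    using n(2) mult_left_mono[OF d, of "\<epsilon> / 2"] \<open>\<epsilon> > 0\<close> by linarith
  ultimately have "p (y - smul (of_real d) x) < \<epsilon> * d"
    using seminorm_triangle_via[OF p, of y "smul (of_real d) x" "?Y n"] seminorm_commute[OF p, of y "?Y n"] by linarith
  moreover have "smul (1 / of_real d) y - x = smul (1 / of_real d) (y - smul (of_real d) x)"
    using \<open>d > 0\<close> by (simp add: scale_right_diff_distrib)
  ultimately have "p (smul (1 / of_real d) y - x) < \<epsilon>"
    using \<open>d > 0\<close> by (simp only: seminorm_scale[OF p]) (simp add: norm_divide field_simps)
  moreover have "smul (1 / of_real d) y \<in> V" using V y(1) by (rule subspace_scale)
  ultimately show "\<exists>y\<in>V. p (y - x) < \<epsilon>" by blast
qed

section \<open>Eigenvectors of the generator\<close>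

lemma exp_difference_quotient:
  "((\<lambda>h. (exp (c * complex_of_real h) - 1) / complex_of_real h) \<longlongrightarrow> c) (at_right 0)"
proof -
  have "((\<lambda>z. exp (c * z)) has_field_derivative c) (at 0)"
    by (auto intro!: derivative_eq_intros)
  then have "((\<lambda>z. (exp (c * z) - 1) / z) \<longlongrightarrow> c) (at 0)"
    by (simp add: DERIV_def)
  moreover have "filterlim complex_of_real (at 0) (at_right 0)"
    unfolding filterlim_at
    by (auto intro!: tendsto_eq_intros simp: eventually_at_filter)
  ultimately show ?thesis by (rule filterlim_compose)
qed

text \<open>
  If \<open>A x = \<mu> x\<close>, then \<open>f s = e\<^bsup>-\<mu>s\<^esup> T(s) x\<close> has vanishing right derivative: it is the image
  under the continuous operator \<open>e\<^bsup>-\<mu>s\<^esup> T(s)\<close> of the one at \<open>0\<close>. For each seminorm \<open>p\<close> this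
  gives \<open>p (f t - x) \<le> \<epsilon> t\<close> with arbitrary \<open>\<epsilon> > 0\<close>, and hence \<open>f t = x\<close> in a Hausdorff space.
  Only right derivatives are used, because at \<open>s > 0\<close> the left derivative would involve operators
  \<open>T(s - h)\<close> that vary with the increment.
\<close>

lemma eigenvector_of_generator_iff:
  assumes semigroup: "operator_semigroup smul T" and strong: "strongly_continuous T"
  shows "x \<in> ker_minus smul \<mu> (generator_domain smul T) (generator smul T) \<longleftrightarrow>
    (\<forall>t\<ge>0. T t x = smul (exp (\<mu> * of_real t)) x)"
proof
  let ?q = "difference_quotient smul T x"
  assume "\<forall>t\<ge>0. T t x = smul (exp (\<mu> * of_real t)) x"
  then have q: "smul ((exp (\<mu> * of_real h) - 1) / of_real h) x = ?q h" if "h > 0" for h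
    using that by (simp add: difference_quotient_def scale_right_diff_distrib scale_left_diff_distrib diff_divide_distrib)
  have "((\<lambda>h. smul ((exp (\<mu> * of_real h) - 1) / of_real h) x) \<longlongrightarrow> smul \<mu> x) (at_right 0)"
    by (intro tendsto_smul exp_difference_quotient tendsto_const)
  then have "(?q \<longlongrightarrow> smul \<mu> x) (at_right 0)"
    by (rule Lim_transform_eventually) (use q in \<open>auto simp: eventually_at_filter\<close>)
  then show "x \<in> ker_minus smul \<mu> (generator_domain smul T) (generator smul T)"
    unfolding ker_minus_def generator_domain_def generator_def using tendsto_Lim by force
next
  let ?q = "difference_quotient smul T x"
  assume "x \<in> ker_minus smul \<mu> (generator_domain smul T) (generator smul T)"
  then obtain y where y: "(?q \<longlongrightarrow> y) (at_right 0)" "generator smul T x = smul \<mu> x"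
    by (auto simp: ker_minus_def generator_domain_def)
  then have q: "(?q \<longlongrightarrow> smul \<mu> x) (at_right 0)"
    using tendsto_Lim[OF _ y(1)] by (simp add: generator_def)
  define f where "f s = smul (exp (- \<mu> * of_real s)) (T s x)" for s
  have f_cont: "continuous_on {0..} f"
    unfolding continuous_on_def f_def
  proof
    fix s :: real assume "s \<in> {0..}"
    then have "((\<lambda>s. T s x) \<longlongrightarrow> T s x) (at s within {0..})"
      using strong by (simp add: strongly_continuous_def continuous_on_def)
    then show "((\<lambda>s. smul (exp (- \<mu> * of_real s)) (T s x)) \<longlongrightarrow> smul (exp (- \<mu> * of_real s)) (T s x))
        (at s within {0..})"
      by (intro tendsto_smul tendsto_intros)
  qed
  have f0: "f 0 = x" using semigroup by (simp add: f_def operator_semigroup_def)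
  define Q where "Q h = smul (1 / of_real h) (f h - x)" for h :: real
  have Q: "(Q \<longlongrightarrow> 0) (at_right 0)"
  proof -
    have "((\<lambda>h. smul (exp (- \<mu> * of_real h)) (?q h) + smul ((exp (- \<mu> * of_real h) - 1) / of_real h) x)
        \<longlongrightarrow> smul (exp (- \<mu> * of_real 0)) (smul \<mu> x) + smul (- \<mu>) x) (at_right 0)"
      by (intro tendsto_plus tendsto_smul tendsto_intros q exp_difference_quotient)
    moreover have "(\<lambda>h. smul (exp (- \<mu> * of_real h)) (?q h) + smul ((exp (- \<mu> * of_real h) - 1) / of_real h) x) = Q"
      by (simp add: fun_eq_iff Q_def f_def difference_quotient_def scale_right_diff_distrib
          scale_left_diff_distrib diff_divide_distrib mult.commute)
    ultimately show ?thesis by (simp add: scale_minus_left)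
  qed
  have shift: "f (s + h) - f s = smul (of_real h) (smul (exp (- \<mu> * of_real s)) (T s (Q h)))"
    if "0 \<le> s" "0 < h" for s h
  proof -
    interpret Ts: Vector_Spaces.linear smul smul "T s"
      using semigroup that by (simp add: operator_semigroup_def continuous_linear_operator_def)
    have Tx: "T (s + h) x = T s (T h x)" using semigroup that by (simp add: operator_semigroup_def)
    have "f (s + h) = smul (exp (- \<mu> * of_real s)) (T s (f h))"
      unfolding f_def Tx of_real_add distrib_left exp_add Ts.scale scale_scale ..
    then have "f (s + h) - f s = smul (exp (- \<mu> * of_real s)) (T s (f h - x))"
      unfolding Ts.diff scale_right_diff_distrib f_def by simp
    then show ?thesis using that by (simp add: Q_def Ts.scale)
  qed
  have le: "p (f t - x) \<le> \<epsilon> * t" if p: "p \<in> \<Gamma>" and "\<epsilon> > 0" "0 \<le> t" for p \<epsilon> t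
  proof -
    have "p (f t - x) - \<epsilon> * t \<le> 0"
    proof (rule le_zero_by_right_increments[OF _ _ _ \<open>0 \<le> t\<close>])
      show "continuous_on {0..} (\<lambda>t. p (f t - x) - \<epsilon> * t)"
        by (intro continuous_intros continuous_on_seminorm_dist[OF p f_cont])
      show "p (f 0 - x) - \<epsilon> * 0 \<le> 0" by (simp add: f0 seminorm_zero[OF p])
      fix s :: real assume "0 \<le> s"
      then have Ts: "Vector_Spaces.linear smul smul (T s)" "continuous_on UNIV (T s)"
        using semigroup by (auto simp: operator_semigroup_def continuous_linear_operator_def)
      interpret Ts: Vector_Spaces.linear smul smul "T s" by (rule Ts)
      have "((\<lambda>h. T s (Q h)) \<longlongrightarrow> T s 0) (at_right 0)"
        by (rule continuous_on_tendsto_compose[OF Ts(2) Q]) auto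
      from tendsto_smul[OF tendsto_const this]
      have "((\<lambda>h. smul (exp (- \<mu> * of_real s)) (T s (Q h))) \<longlongrightarrow> 0) (at_right 0)" by simp
      from tendsto_seminorm[OF p this]
      have "eventually (\<lambda>h. p (smul (exp (- \<mu> * of_real s)) (T s (Q h))) < \<epsilon>) (at_right 0)"
        using order_tendstoD(2) \<open>\<epsilon> > 0\<close> by fastforce
      then show "eventually (\<lambda>h. p (f (s + h) - x) - \<epsilon> * (s + h) \<le> p (f s - x) - \<epsilon> * s) (at_right 0)"
        using eventually_at_right_less[of "0::real"]
      proof eventually_elim
        case (elim h)
        have "p (f (s + h) - f s) = h * p (smul (exp (- \<mu> * of_real s)) (T s (Q h)))"
          unfolding shift[OF \<open>0 \<le> s\<close> elim(2)] seminorm_scale[OF p, of "of_real h"] using elim(2) by simp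
        also have "\<dots> \<le> h * \<epsilon>" using elim by (intro mult_left_mono) auto
        finally show ?case
          using seminorm_triangle_via[OF p, of "f (s + h)" x "f s"] by (simp add: algebra_simps)
      qed
    qed
    then show ?thesis by simp
  qed
  show "\<forall>t\<ge>0. T t x = smul (exp (\<mu> * of_real t)) x"
  proof (intro allI impI)
    fix t :: real assume "0 \<le> t"
    have "f t - x = 0"
    proof (rule eq_zero_if_seminorms_zero)
      fix p assume p: "p \<in> \<Gamma>"
      have "p (f t - x) \<le> 0 + e" if "e > 0" for e
      proof -
        have "p (f t - x) \<le> e / (t + 1) * t" using le[OF p, of "e / (t + 1)" t] that \<open>0 \<le> t\<close> by simp
        also have "\<dots> \<le> e" using that \<open>0 \<le> t\<close> by (simp add: field_simps)
        finally show ?thesis by simp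
      qed
      then have "p (f t - x) \<le> 0" by (rule field_le_epsilon)
      then show "p (f t - x) = 0" using seminorm_nonneg[OF p, of "f t - x"] by linarith
    qed
    then have "smul (exp (\<mu> * of_real t)) (f t) = smul (exp (\<mu> * of_real t)) x" by simp
    then show "T t x = smul (exp (\<mu> * of_real t)) x"
      by (simp add: f_def flip: exp_add)
  qed
qed

text \<open>
  The spectral projection of \<open>x\<close>: the mean of \<open>e\<^bsup>-\<mu>s\<^esup> T(s) x\<close> over a period \<open>t\<close>. Applying \<open>T(r)\<close>
  to the integrand gives \<open>e\<^bsup>\<mu>r\<^esup>\<close> times the integrand shifted by \<open>r / t\<close> in the rescaled time,
  and the limit of the Riemann sums is insensitive to the shift.
\<close>

lemma orbit_mean_eigenvector:
  assumes complete: "sequentially_complete TYPE('a)"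
    and semigroup: "operator_semigroup smul T" and strong: "strongly_continuous T"
    and "t > 0" and period: "T t x = smul (exp (\<mu> * of_real t)) x"
  defines "h \<equiv> \<lambda>s. smul (exp (- \<mu> * of_real (t * s))) (T (t * s) x)"
  shows "continuous_on {0..} h"
    and "\<And>s. 0 \<le> s \<Longrightarrow> h (s + 1) = h s"
    and "\<exists>y \<in> ker_minus smul \<mu> (generator_domain smul T) (generator smul T).
      (\<lambda>n. mean n (\<lambda>j. h (real j / real n))) \<longlonglongrightarrow> y"
proof -
  have T_plus: "T (r + s) z = T r (T s z)" if "0 \<le> r" "0 \<le> s" for r s z
    using semigroup that by (simp add: operator_semigroup_def)
  have lin: "Vector_Spaces.linear smul smul (T r)" and cont: "continuous_on UNIV (T r)" if "0 \<le> r" for r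
    using semigroup that by (auto simp: operator_semigroup_def continuous_linear_operator_def)
  have T_smul: "T r (smul c z) = smul c (T r z)" if "0 \<le> r" for r c z
  proof -
    interpret Vector_Spaces.linear smul smul "T r" using that by (rule lin)
    show ?thesis by (rule scale)
  qed
  show h_cont: "continuous_on {0..} h"
    unfolding continuous_on_def h_def
  proof
    fix s :: real assume s: "s \<in> {0..}"
    have "continuous_on {0..} (\<lambda>s. T s x)" using strong by (simp add: strongly_continuous_def)
    then have "((\<lambda>s. T (t * s) x) \<longlongrightarrow> T (t * s) x) (at s within {0..})"
      using s \<open>t > 0\<close>
      by - (rule continuous_on_tendsto_compose, auto intro!: tendsto_intros simp: eventually_at_filter)
    then show "((\<lambda>s. smul (exp (- \<mu> * of_real (t * s))) (T (t * s) x)) \<longlongrightarrow>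
        smul (exp (- \<mu> * of_real (t * s))) (T (t * s) x)) (at s within {0..})"
      by (intro tendsto_smul tendsto_intros)
  qed
  show h_period: "h (s + 1) = h s" if "0 \<le> s" for s
    using that \<open>t > 0\<close> T_plus[of "t * s" t x] T_smul[of "t * s"] period
    by (simp add: h_def ring_distribs flip: exp_add)
  have h_shift: "T r (h s) = smul (exp (\<mu> * of_real r)) (h (s + r / t))" if "0 \<le> r" "0 \<le> s" for r s
    using that \<open>t > 0\<close> T_plus[of r "t * s" x] 
    by (simp add: h_def ring_distribs T_smul add.commute flip: exp_add)
  let ?R = "\<lambda>n. mean n (\<lambda>j. h (real j / real n))"
  have "cauchy_seq ?R"
    by (rule riemann_sums_cauchy, rule continuous_on_subset[OF h_cont]) auto
  then obtain y where y: "?R \<longlonglongrightarrow> y"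
    using complete unfolding sequentially_complete_def convergent_def by blast
  have "T r y = smul (exp (\<mu> * of_real r)) y" if "0 \<le> r" for r
  proof (rule LIMSEQ_unique)
    show "(\<lambda>n. T r (?R n)) \<longlonglongrightarrow> T r y"
      by (rule continuous_on_tendsto_compose[OF cont[OF that] y]) auto
    have "(\<lambda>n. mean n (\<lambda>j. h (real j / real n + r / t))) \<longlonglongrightarrow> y"
      using that \<open>t > 0\<close> by (intro riemann_sums_shift[OF h_cont h_period _ y]) auto
    then have "(\<lambda>n. smul (exp (\<mu> * of_real r)) (mean n (\<lambda>j. h (real j / real n + r / t))))
        \<longlonglongrightarrow> smul (exp (\<mu> * of_real r)) y"
      by (intro tendsto_smul tendsto_const)
    moreover have "T r (?R n) = smul (exp (\<mu> * of_real r)) (mean n (\<lambda>j. h (real j / real n + r / t)))" for n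
      using h_shift[OF that] by (simp add: mean_linear[OF lin[OF that]] mean_smul)
    ultimately show "(\<lambda>n. T r (?R n)) \<longlonglongrightarrow> smul (exp (\<mu> * of_real r)) y" by simp
  qed
  then show "\<exists>y \<in> ker_minus smul \<mu> (generator_domain smul T) (generator smul T). ?R \<longlonglongrightarrow> y"
    using y eigenvector_of_generator_iff[OF semigroup strong] by blast
qed

lemma closed_eigenspace:
  assumes "continuous_linear_operator smul S"
  shows "closed {x. S x = smul c x}" and "module.subspace smul {x. S x = smul c x}"
proof -
  interpret S: Vector_Spaces.linear smul smul S
    using assms by (simp add: continuous_linear_operator_def)
  have "continuous_on UNIV (smul c)"
    unfolding continuous_on_def by (intro ballI tendsto_smul tendsto_const tendsto_ident_at)
  then show "closed {x. S x = smul c x}"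
    using assms by (intro closed_Collect_eq) (auto simp: continuous_linear_operator_def)
  show "module.subspace smul {x. S x = smul c x}"
    by (auto simp: subspace_def S.add S.scale scale_right_distrib mult.commute)
qed

end

section \<open>Kernels of the semigroup and of its generator\<close>

theorem corollary5p5:
  fixes smul :: "complex \<Rightarrow> 'a::{ab_group_add, t2_space} \<Rightarrow> 'a"
    and \<Gamma> :: "('a \<Rightarrow> real) set"
    and T :: "real \<Rightarrow> 'a \<Rightarrow> 'a"
    and lam :: complex
  assumes lcs: "hausdorff_lcs smul \<Gamma>"
    and complete: "sequentially_complete TYPE('a)"
    and semigroup: "operator_semigroup smul T"
    and strong: "strongly_continuous T"
  shows
    "ker_minus smul lam (generator_domain smul T) (generator smul T) =
       (\<Inter>t\<in>{0..}. ker_minus smul (exp (lam * complex_of_real t)) UNIV (T t)) \<and>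
     (locally_equicontinuous \<Gamma> T \<longrightarrow>
      (\<forall>t>0. ker_minus smul (exp (lam * complex_of_real t)) UNIV (T t) =
        closure (module.span smul
          (\<Union>n::int. ker_minus smul
             (lam + 2 * complex_of_real pi * \<i> * of_int n / complex_of_real t)
             (generator_domain smul T) (generator smul T)))))"
proof -
  interpret hausdorff_lcs smul \<Gamma> by (rule lcs)
  let ?E = "\<lambda>\<mu>. ker_minus smul \<mu> (generator_domain smul T) (generator smul T)"
  note eigen = eigenvector_of_generator_iff[OF semigroup strong]
  have a: "?E lam = (\<Inter>t\<in>{0..}. ker_minus smul (exp (lam * complex_of_real t)) UNIV (T t))"
    by (auto simp: eigen) (auto simp: ker_minus_def)
  have "ker_minus smul (exp (lam * complex_of_real t)) UNIV (T t) =
        closure (module.span smul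
          (\<Union>n::int. ?E (lam + 2 * complex_of_real pi * \<i> * of_int n / complex_of_real t)))"
    (is "?K = _") if "t > 0" for t
  proof
    let ?\<mu> = "\<lambda>n::int. lam + 2 * complex_of_real pi * \<i> * of_int n / complex_of_real t"
    have exp_\<mu>: "exp (?\<mu> n * complex_of_real t) = exp (lam * complex_of_real t)" for n
    proof -
      have "?\<mu> n * complex_of_real t = lam * complex_of_real t + of_real (2 * of_int n * pi) * \<i>"
        using that by (simp add: field_simps)
      then show ?thesis by (simp only: exp_add exp_integer_2pi Ints_of_int mult_1_right)
    qed
    have K: "?K = {x. T t x = smul (exp (lam * complex_of_real t)) x}" by (simp add: ker_minus_def)
    have "continuous_linear_operator smul (T t)"
      using semigroup that by (simp add: operator_semigroup_def)
    note closed_K = closed_eigenspace[OF this, of "exp (lam * complex_of_real t)"]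
    have "(\<Union>n. ?E (?\<mu> n)) \<subseteq> ?K"
      using that exp_\<mu> by (auto simp: eigen K)
    then show "closure (module.span smul (\<Union>n. ?E (?\<mu> n))) \<subseteq> ?K"
      unfolding K by (intro closure_minimal span_minimal closed_K)
    show "?K \<subseteq> closure (module.span smul (\<Union>n. ?E (?\<mu> n)))"
    proof
      fix x assume "x \<in> ?K"
      then have x: "T t x = smul (exp (lam * complex_of_real t)) x" by (simp add: K)
      define h where "h n s = smul (exp (- ?\<mu> n * of_real (t * s))) (T (t * s) x)" for n s
      have per: "T t x = smul (exp (?\<mu> n * complex_of_real t)) x" for n using x by (simp only: exp_\<mu>)
      note mean_props = orbit_mean_eigenvector[OF complete semigroup strong that per, folded h_def]
      \<comment> \<open>Multiplication by a character turns the orbit normalised by \<open>\<lambda>\<close> into the one normalised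
        by \<open>\<lambda> - 2\<pi>ik/t\<close>, hence the index \<open>- k\<close>.\<close>
      have h_char: "smul (character k s) (h 0 s) = h (- k) s" for k s
      proof -
        have "2 * of_real pi * \<i> * of_int k * of_real s + - ?\<mu> 0 * of_real (t * s)
            = - ?\<mu> (- k) * of_real (t * s)"
          using that by (simp add: field_simps)
        then show ?thesis by (simp add: h_def character_def flip: exp_add)
      qed
      show "x \<in> closure (module.span smul (\<Union>n. ?E (?\<mu> n)))"
      proof (rule value_in_closure_of_fourier_coefficients)
        show "continuous_on {0..1} (h 0)"
          by (rule continuous_on_subset[OF mean_props(1)]) auto
        show h0: "h 0 0 = x" using semigroup by (simp add: h_def operator_semigroup_def)
        show "h 0 1 = x" using mean_props(2)[of 0 0] h0 by simp
        show "\<exists>y\<in>module.span smul (\<Union>n. ?E (?\<mu> n)).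
          (\<lambda>n. mean n (\<lambda>j. smul (character k (real j / real n)) (h 0 (real j / real n)))) \<longlonglongrightarrow> y" for k
          using mean_props(3)[of "- k"] unfolding h_char by (blast intro: span_base)
      qed (rule subspace_span)
    qed
  qed
  with a show ?thesis by blast
qed

end
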